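(* Let $D=(V,A)$ be a directed graph (possibly infinite, of arbitrary cardinality). Then $A$ can be partitioned into directed cycles if and only if for every $X\subseteq V$ the cardinality of the set of edges going into $X$ equals the cardinality of the set of edges going out of $X$, i.e. $|\mathsf{in}_D(X)|=|\mathsf{out}_D(X)|$.
   Context: For $X\subseteq V$, $\mathsf{out}_D(X)$ denotes the set of edges of $D$ with tail in $X$ and head in $V\setminus X$, and $\mathsf{in}_D(X)$ denotes the set of edges with head in $X$ and tail in $V\setminus X$. Cardinalities may be infinite cardinals. A directed cycle (dicycle) is a finite directed cycle. *)

theory Defs
  imports
    "Graph_Theory.Arc_Walk"
    "HOL-Library.Disjoint_Sets"
    "HOL-Library.Equipollence"
begin

definition out_cut :: "('a, 'b) pre_digraph \<Rightarrow> 'a set \<Rightarrow> 'b set" where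
  "out_cut D X = {e \<in> arcs D. tail D e \<in> X \<and> head D e \<in> verts D - X}"

definition in_cut :: "('a, 'b) pre_digraph \<Rightarrow> 'a set \<Rightarrow> 'b set" where
  "in_cut D X = {e \<in> arcs D. head D e \<in> X \<and> tail D e \<in> verts D - X}"

text \<open>
  A directed cycle is identified with its set of arcs. The library's notion of cycle
  is a nonempty closed walk, given as a finite list of arcs, that repeats no vertex;
  a loop is a cycle of length one, and a pair of opposite arcs is a cycle of length two.
\<close>

definition dicycle_arcs :: "('a, 'b) pre_digraph \<Rightarrow> 'b set \<Rightarrow> bool" where
  "dicycle_arcs D C \<longleftrightarrow> (\<exists>p. pre_digraph.cycle D p \<and> C = set p)"

definition dicycle_partition :: "('a, 'b) pre_digraph \<Rightarrow> 'b set set \<Rightarrow> bool" where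
  "dicycle_partition D P \<longleftrightarrow> partition_on (arcs D) P \<and> (\<forall>C\<in>P. dicycle_arcs D C)"

end

(*
Write bal(E) for the condition that opposite cuts of the arc set E have equal size. If bal(E),
every arc of E lies on a cycle, and removing a cycle preserves bal(E); enumerating E therefore
decomposes it when it is countable. For uncountable E, use induction on |E|: well-order E in its
minimal order type and consider the hulls M(a) of the initial segments up to a under finitely
many finitary Skolem-type operations. The pieces M(a) - (union of M(b) for b < a) partition E into
smaller sets, so it suffices that each piece satisfies the condition.

Say that u is linked to v up to a cardinal k if no k arcs separate v from u. Under bal(E) this
relation is symmetric. If f lies outside a closed set N of size k, and a closed walk through f meets
N, then a segment of the walk around f leads outside N from an end u of N to an end v of N. Since N
contains a separator of size at most k whenever one exists, u is linked to v up to k, hence v to u,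
and enough disjoint walks from v to u are available to close up the segment outside N and outside
any prescribed small set of arcs. Applied to a cut of the piece, this shows that the arcs leaving
the cut cannot outnumber those entering it.
*)

theory Submission
  imports Defs "HOL-Algebra.Free_Abelian_Groups"
begin

section \<open>Cardinalities\<close>

lemma lepoll_total: "A \<lesssim> B \<or> B \<lesssim> A"
  by (metis card_of_Well_order card_of_ordLeq lepoll_def ordLeq_total)

lemma not_lepoll_iff: "\<not> A \<lesssim> B \<longleftrightarrow> B \<prec> A"
  by (meson eqpoll_imp_lepoll eqpoll_sym lepoll_antisym lepoll_total lesspoll_def)

lemma UN_lepoll:
  assumes "infinite B" "I \<lesssim> B" "\<And>i. i \<in> I \<Longrightarrow> A i \<lesssim> B"
  shows "(\<Union>i\<in>I. A i) \<lesssim> B"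
  using assms card_of_UNION_ordLeq_infinite[of B I A]
  by (simp add: lepoll_def card_of_ordLeq)

lemma Un_lepoll:
  assumes "infinite B" "A \<lesssim> B" "C \<lesssim> B"
  shows "A \<union> C \<lesssim> B"
proof -
  have "\<Union> {A, C} \<lesssim> B"
    using assms UN_lepoll[of B "{A, C}" "\<lambda>X. X"] by (auto simp: finite_lepoll_infinite)
  then show ?thesis by simp
qed

lemma times_lepoll:
  assumes "infinite B" "A \<lesssim> B" "C \<lesssim> B"
  shows "A \<times> C \<lesssim> B"
proof -
  have "B \<times> B \<approx> B"
    using assms(1) card_of_Times_same_infinite by (simp add: eqpoll_iff_card_of_ordIso)
  then show ?thesis
    using times_lepoll_mono[OF assms(2,3)] lepoll_trans2 by blast
qed

text \<open>If every member met \<open>B\<close>, choosing a common point for each index would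
  inject \<open>I\<close> into \<open>B\<close>. This later selects, among many disjoint walks, one
  that misses a smaller set.\<close>

lemma disjoint_family_avoids:
  assumes "\<not> I \<lesssim> B" "\<And>i j. i \<in> I \<Longrightarrow> j \<in> I \<Longrightarrow> i \<noteq> j \<Longrightarrow> A i \<inter> A j = {}"
  obtains i where "i \<in> I" "A i \<inter> B = {}"
proof (rule ccontr)
  assume "\<not> thesis"
  then have "\<forall>i\<in>I. \<exists>x. x \<in> A i \<inter> B" using that by blast
  then obtain f where f: "\<And>i. i \<in> I \<Longrightarrow> f i \<in> A i \<inter> B" by metis
  have "inj_on f I"
  proof (rule inj_onI, rule ccontr)
    fix i j assume ij: "i \<in> I" "j \<in> I" "f i = f j" "i \<noteq> j"
    then have "f i \<in> A i \<inter> A j" using f[of i] f[of j] by simp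
    then show False using assms(2)[OF ij(1,2,4)] by simp
  qed
  moreover have "f ` I \<subseteq> B" using f by blast
  ultimately have "I \<lesssim> B" unfolding lepoll_def by blast
  then show False using assms(1) by blast
qed

lemma lesspoll_iff_ordLess: "A \<prec> B \<longleftrightarrow> |A| <o |B|"
  by (metis card_of_ordLeq lepoll_def not_lepoll_iff card_of_Well_order not_ordLeq_iff_ordLess)

text \<open>The proper initial segments of a well-order of minimal order type on \<open>E\<close>.\<close>

locale initial_segments =
  fixes E :: "'e set" and seg :: "'e \<Rightarrow> 'e set"
  assumes seg_subset: "seg a \<subseteq> E"
    and seg_irrefl: "a \<notin> seg a"
    and seg_wf: "wf {(b, a). b \<in> seg a}"
    and seg_linear: "a \<in> E \<Longrightarrow> b \<in> E \<Longrightarrow> a = b \<or> a \<in> seg b \<or> b \<in> seg a"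
    and seg_trans: "c \<in> seg b \<Longrightarrow> b \<in> seg a \<Longrightarrow> c \<in> seg a"
    and seg_small: "a \<in> E \<Longrightarrow> seg a \<prec> E"
    and seg_eqpoll: "(B :: 'e set) \<prec> E \<Longrightarrow> \<exists>a\<in>E. seg a \<approx> B"
begin

lemma seg_mono: "b \<in> seg a \<Longrightarrow> seg b \<subseteq> seg a"
  using seg_trans by blast

lemma seg_mono_iff: "a \<in> E \<Longrightarrow> b \<in> E \<Longrightarrow> b \<notin> seg a \<Longrightarrow> seg a \<subseteq> seg b"
  using seg_linear seg_mono by blast

lemma least_exists:
  assumes "a \<in> E" "P a"
  obtains b where "b \<in> E" "P b" "\<And>c. c \<in> E \<Longrightarrow> P c \<Longrightarrow> c \<notin> seg b" "seg b \<subseteq> seg a"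
proof -
  obtain b where b: "b \<in> {a \<in> E. P a}" "\<And>c. (c, b) \<in> {(b, a). b \<in> seg a} \<Longrightarrow> c \<notin> {a \<in> E. P a}"
    using wfE_min[OF seg_wf, of a "{a \<in> E. P a}"] assms by blast
  then show thesis using that[of b] assms seg_mono_iff[of b a] by blast
qed

end

lemma initial_segments_exist:
  fixes E :: "'e set"
  obtains seg where "initial_segments E seg"
proof -
  \<comment> \<open>\<open>|E|\<close> is a well-order on \<open>E\<close> itself of minimal order
    type, so its strict lower sections are smaller than \<open>E\<close> and realise every smaller
    cardinality.\<close>
  let ?r = "|E|"
  have wo: "wo_rel ?r" by (simp add: wo_rel_def card_of_Well_order)
  have F: "Field ?r = E" by (rule Field_card_of)
  have lin: "linear_order_on E ?r" using card_of_well_order_on[of E] well_order_on_def by blast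
  have "initial_segments E (underS ?r)"
  proof
    show "underS ?r a \<subseteq> E" for a
      using underS_Field[of _ ?r a] F by blast
    show "a \<notin> underS ?r a" for a by (simp add: underS_def)
    have "wf (?r - Id)" using wo_rel.WELL[OF wo] by (simp add: well_order_on_def)
    then show "wf {(b, a). b \<in> underS ?r a}"
      by (rule wf_subset) (auto simp: underS_def)
    show "a = b \<or> a \<in> underS ?r b \<or> b \<in> underS ?r a" if "a \<in> E" "b \<in> E" for a b
      using wo_rel.TOTALS[OF wo] that F by (auto simp: underS_def)
    show "c \<in> underS ?r a" if "c \<in> underS ?r b" "b \<in> underS ?r a" for a b c
      using that wo_rel.TRANS[OF wo] wo_rel.ANTISYM[OF wo]
      unfolding underS_def trans_def antisym_def by blast
    show "underS ?r a \<prec> E" if "a \<in> E" for a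
      using card_of_underS[OF card_of_Card_order] that F lesspoll_iff_ordLess by metis
    show "\<exists>a\<in>E. underS ?r a \<approx> B" if "B \<prec> E" for B :: "'e set"
    proof -
      have "|B| <o ?r" using that by (simp add: lesspoll_iff_ordLess)
      then obtain a where a: "a \<in> Field ?r" "|B| =o Restr ?r (underS ?r a)"
        using ordLess_iff_ordIso_Restr[of ?r "|B|"] card_of_Well_order by blast
      have "Field (Restr ?r (underS ?r a)) = underS ?r a"
        by (simp add: wo wo_rel.underS_ofilter Field_Restr_ofilter card_of_Well_order)
      then have "|B| =o |underS ?r a|"
        using card_of_cong[OF a(2)] F by (metis Field_card_of)
      then show ?thesis
        using a(1) F eqpoll_iff_card_of_ordIso eqpoll_sym by blast
    qed
  qed
  then show thesis by (rule that)
qed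

section \<open>Closure under finitary operations\<close>

text \<open>Letting \<open>G\<close> act on finite sets encodes finitely many operations of any
  arity in a single map.\<close>

definition closed_under :: "('e set \<Rightarrow> 'e set) \<Rightarrow> 'e set \<Rightarrow> bool" where
  "closed_under G N \<longleftrightarrow> (\<forall>F. finite F \<longrightarrow> F \<subseteq> N \<longrightarrow> G F \<subseteq> N)"

definition closure_under :: "('e set \<Rightarrow> 'e set) \<Rightarrow> 'e set \<Rightarrow> 'e set" where
  "closure_under G S = \<Inter> {N. S \<subseteq> N \<and> closed_under G N}"

lemma closed_closure_under: "closed_under G (closure_under G S)"
  unfolding closure_under_def closed_under_def by blast

lemma subset_closure_under: "S \<subseteq> closure_under G S"
  unfolding closure_under_def by blast

lemma closure_under_least: "S \<subseteq> N \<Longrightarrow> closed_under G N \<Longrightarrow> closure_under G S \<subseteq> N"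
  unfolding closure_under_def by blast

lemma closure_under_mono: "S \<subseteq> T \<Longrightarrow> closure_under G S \<subseteq> closure_under G T"
  unfolding closure_under_def by blast

text \<open>A finite subset of the union of a chain already lies in one member, and \<open>G\<close>
  consults only finite subsets.\<close>

lemma closed_under_UN_chain:
  assumes "\<And>i. i \<in> I \<Longrightarrow> closed_under G (M i)" "I \<noteq> {}"
    and "\<And>i j. i \<in> I \<Longrightarrow> j \<in> I \<Longrightarrow> M i \<subseteq> M j \<or> M j \<subseteq> M i"
  shows "closed_under G (\<Union>i\<in>I. M i)"
  unfolding closed_under_def
proof (intro allI impI)
  fix F assume F: "finite F" "F \<subseteq> (\<Union>i\<in>I. M i)"
  have "subset.chain UNIV (M ` I)" using assms(3) by (auto simp: subset_chain_def)
  then obtain B where "B \<in> M ` I" "F \<subseteq> B"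
    using finite_subset_Union_chain[OF F] assms(2) by (metis image_is_empty)
  then obtain i where i: "i \<in> I" "F \<subseteq> M i" by auto
  then have "G F \<subseteq> M i" using assms(1)[OF i(1)] F(1) by (simp add: closed_under_def)
  then show "G F \<subseteq> (\<Union>i\<in>I. M i)" using i(1) by auto
qed

text \<open>The closure is reached after countably many rounds. An infinite set has only as many
  finite subsets as elements, and each contributes finitely many new elements, so no round increases
  the cardinality.\<close>

lemma closure_under_lepoll:
  assumes "infinite S" "\<And>F. finite F \<Longrightarrow> finite (G F)"
  shows "closure_under G S \<lesssim> S"
proof -
  define T where "T n = ((\<lambda>X. X \<union> (\<Union>F\<in>Fpow X. G F)) ^^ n) S" for n
  have T0: "T 0 = S" and TS: "T (Suc n) = T n \<union> (\<Union>F\<in>Fpow (T n). G F)" for n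
    by (simp_all add: T_def)
  have inc: "T m \<subseteq> T n" if "m \<le> n" for m n
    using lift_Suc_mono_le[of T] TS that by blast
  have small: "T n \<lesssim> S" for n
  proof (induction n)
    case (Suc n)
    have inf: "infinite (T n)" using inc[of 0 n] T0 assms(1) infinite_super by blast
    have "(\<Union>F\<in>Fpow (T n). G F) \<lesssim> S"
    proof (rule UN_lepoll[OF assms(1)])
      show "Fpow (T n) \<lesssim> S"
        using eqpoll_Fpow[OF inf] Suc lepoll_trans1 by blast
      show "G F \<lesssim> S" if "F \<in> Fpow (T n)" for F
        using that assms finite_lepoll_infinite unfolding Fpow_def by blast
    qed
    then show ?case unfolding TS using Un_lepoll[OF assms(1)] Suc by blast
  qed (simp add: T0)
  have "closed_under G (\<Union>n. T n)"
    unfolding closed_under_def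
  proof (intro allI impI)
    fix F assume F: "finite F" "F \<subseteq> (\<Union>n. T n)"
    have "subset.chain UNIV (range T)"
      unfolding subset_chain_def using inc by (metis UNIV_I imageE nat_le_linear subset_UNIV)
    then obtain n where "F \<subseteq> T n"
      using finite_subset_Union_chain[of F "range T" UNIV] F by blast
    then have "G F \<subseteq> T (Suc n)" using F(1) unfolding TS Fpow_def by blast
    then show "G F \<subseteq> (\<Union>n. T n)" by blast
  qed
  then have "closure_under G S \<subseteq> (\<Union>n. T n)"
    using closure_under_least[of S "\<Union>n. T n" G] T0 by blast
  moreover have "(\<Union>n. T n) \<lesssim> S"
    using assms(1) small infinite_le_lepoll by (intro UN_lepoll) auto
  ultimately show ?thesis using subset_imp_lepoll lepoll_trans by blast
qed

section \<open>Cuts and reachability\<close>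

context pre_digraph
begin

text \<open>The complement is taken in the whole type rather than in \<open>verts G\<close>, so the
  arcs entering \<open>X\<close> are simply \<open>cut E (- X)\<close>.\<close>

definition cut :: "'b set \<Rightarrow> 'a set \<Rightarrow> 'b set" where
  "cut E X = {e \<in> E. tail G e \<in> X \<and> head G e \<notin> X}"

definition reach :: "'b set \<Rightarrow> 'a \<Rightarrow> 'a \<Rightarrow> bool" where
  "reach E x y \<longleftrightarrow> (x, y) \<in> ((\<lambda>e. (tail G e, head G e)) ` E)\<^sup>*"

definition ends :: "'b set \<Rightarrow> 'a set" where
  "ends N = head G ` N \<union> tail G ` N"

text \<open>Replacing \<open>X\<close> by \<open>- X\<close> gives the reverse comparison, so by
  Schroeder-Bernstein opposite cuts are equipollent.\<close>

definition balanced :: "'b set \<Rightarrow> bool" where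
  "balanced E \<longleftrightarrow> (\<forall>X. cut E X \<lesssim> cut E (- X))"

text \<open>Only the cardinality of \<open>S\<close> matters; a set stands in for the cardinal
  bound.\<close>

definition linked :: "'b set \<Rightarrow> 'b set \<Rightarrow> 'a \<Rightarrow> 'a \<Rightarrow> bool" where
  "linked E S x y \<longleftrightarrow> (\<forall>S'. S' \<lesssim> S \<longrightarrow> reach (E - S') x y)"

definition eulerian :: "'b set \<Rightarrow> bool" where
  "eulerian K \<longleftrightarrow> finite K \<and> (\<forall>X. card (cut K X) = card (cut K (- X)))"

text \<open>Equivalently, \<open>E\<close> is the directed union of its finite Eulerian subsets.
  This finitary form of balance passes to closed sets and suffices for countable
  decompositions.\<close>

definition finitely_eulerian :: "'b set \<Rightarrow> bool" where
  "finitely_eulerian E \<longleftrightarrow> (\<forall>F. finite F \<longrightarrow> F \<subseteq> E \<longrightarrow> (\<exists>K. eulerian K \<and> F \<subseteq> K \<and> K \<subseteq> E))"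

definition decomposable :: "'b set \<Rightarrow> bool" where
  "decomposable E \<longleftrightarrow> (\<exists>P. partition_on E P \<and> (\<forall>C\<in>P. dicycle_arcs G C))"

lemma reach_refl [simp]: "reach E x x"
  by (simp add: reach_def)

lemma reach_trans [trans]: "reach E x y \<Longrightarrow> reach E y z \<Longrightarrow> reach E x z"
  unfolding reach_def by (rule rtrancl_trans)

lemma reach_mono: "reach E x y \<Longrightarrow> E \<subseteq> E' \<Longrightarrow> reach E' x y"
  unfolding reach_def by (rule subsetD[OF rtrancl_mono[OF image_mono]])

lemma reach_arc: "e \<in> E \<Longrightarrow> reach E (tail G e) (head G e)"
  unfolding reach_def by (rule r_into_rtrancl) (rule imageI)

lemma reach_induct [consumes 1, case_names refl step]:
  assumes "reach E x y" "P x"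
    and "\<And>e. e \<in> E \<Longrightarrow> reach E x (tail G e) \<Longrightarrow> P (tail G e) \<Longrightarrow> P (head G e)"
  shows "P y"
  using assms(1) unfolding reach_def
proof (induction rule: rtrancl_induct)
  case (step y z)
  then obtain e where "e \<in> E" "y = tail G e" "z = head G e" by blast
  then show ?case using assms(3)[of e] step by (simp add: reach_def)
qed (rule assms(2))

lemma converse_reach_induct [consumes 1, case_names refl step]:
  assumes "reach E x y" "P y"
    and "\<And>e. e \<in> E \<Longrightarrow> reach E (head G e) y \<Longrightarrow> P (head G e) \<Longrightarrow> P (tail G e)"
  shows "P x"
  using assms(1) unfolding reach_def
proof (induction rule: converse_rtrancl_induct)
  case (step x z)
  then obtain e where "e \<in> E" "x = tail G e" "z = head G e" by blast
  then show ?case using assms(3)[of e] step by (simp add: reach_def)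
qed (rule assms(2))

lemma reach_crosses_cut:
  assumes "reach E x y" "x \<in> X" "y \<notin> X"
  shows "cut E X \<noteq> {}"
proof
  assume empty: "cut E X = {}"
  from assms(1) have "y \<in> X"
    by (induction rule: reach_induct) (use assms(2) empty in \<open>auto simp: cut_def\<close>)
  then show False using assms(3) by simp
qed

lemma cut_reachable_set: "cut E {y. reach E x y} = {}"
  unfolding cut_def using reach_trans[OF _ reach_arc] by auto

lemma reach_finite_subset:
  assumes "reach E x y"
  obtains P where "P \<subseteq> E" "finite P" "reach P x y"
proof -
  from assms have "\<exists>P\<subseteq>E. finite P \<and> reach P x y"
  proof (induction rule: reach_induct)
    case refl
    then show ?case by (intro exI[of _ "{}"]) simp
  next
    case (step e)
    then obtain P where P: "P \<subseteq> E" "finite P" "reach P x (tail G e)" by blast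
    have "reach (insert e P) x (head G e)"
      using reach_trans[OF reach_mono[OF P(3)] reach_arc[of e]] by blast
    then show ?case using P step(1) by (intro exI[of _ "insert e P"]) simp
  qed
  then show thesis using that by blast
qed

lemma linked_mono: "linked E S x y \<Longrightarrow> T \<lesssim> S \<Longrightarrow> linked E T x y"
  unfolding linked_def by (auto intro: lepoll_trans)

text \<open>Suppose \<open>S'\<close> separates \<open>u\<close> from \<open>v\<close>, and let
  \<open>Z\<close> be what \<open>v\<close> still reaches. All arcs leaving \<open>Z\<close> lie in
  \<open>S'\<close>, so by balance at most as many enter \<open>Z\<close>. Deleting those would cut
  off \<open>v\<close> from \<open>u\<close>, against the assumed linkage.\<close>

lemma linked_sym:
  assumes "balanced E" "linked E S u v"
  shows "linked E S v u"
  unfolding linked_def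
proof (intro allI impI, rule ccontr)
  fix S' assume S': "S' \<lesssim> S" "\<not> reach (E - S') v u"
  define Z where "Z = {y. reach (E - S') v y}"
  have "cut E Z \<subseteq> S'"
    using cut_reachable_set[of "E - S'" v] unfolding cut_def Z_def by blast
  moreover have "cut E (- Z) \<lesssim> cut E (- (- Z))"
    using assms(1) unfolding balanced_def by blast
  ultimately have "cut E (- Z) \<lesssim> S"
    using S'(1) subset_imp_lepoll lepoll_trans double_complement by metis
  then have "reach (E - cut E (- Z)) u v"
    using assms(2) unfolding linked_def by blast
  then have "cut (E - cut E (- Z)) (- Z) \<noteq> {}"
    by (rule reach_crosses_cut) (use S'(2) Z_def in auto)
  then show False unfolding cut_def by blast
qed

text \<open>If a closed walk through \<open>f\<close> meets \<open>N\<close>, its portion around \<open>f\<close> is a walk outside \<open>N\<close>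
  between two ends of \<open>N\<close>, which the last hypothesis closes up.\<close>

lemma reroute:
  assumes "f \<in> M - N" "reach M (head G f) (tail G f)"
    and rev: "\<And>u v. u \<in> ends N \<Longrightarrow> v \<in> ends N \<Longrightarrow> reach (M - N) u v \<Longrightarrow> reach (M - N) v u"
  shows "reach (M - N) (head G f) (tail G f)"
proof -
  have first: "reach (M - N) x y \<or> (\<exists>a\<in>ends N. reach (M - N) x a)" if "reach M x y" for x y
    using that
  proof (induction rule: reach_induct)
    case (step e)
    then show ?case
      using reach_trans[of "M - N" x "tail G e" "head G e"] reach_arc[of e "M - N"]
      unfolding ends_def by blast
  qed simp
  have last: "reach (M - N) x y \<or> (\<exists>b\<in>ends N. reach (M - N) b y)" if "reach M x y" for x y
    using that
  proof (induction rule: converse_reach_induct)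
    case (step e)
    then show ?case
      using reach_trans[of "M - N" "tail G e" "head G e" y] reach_arc[of e "M - N"]
      unfolding ends_def by blast
  qed simp
  show ?thesis
  proof (rule ccontr)
    assume no: "\<not> ?thesis"
    obtain a b where ab: "a \<in> ends N" "reach (M - N) (head G f) a"
      "b \<in> ends N" "reach (M - N) b (tail G f)"
      using first[OF assms(2)] last[OF assms(2)] no by blast
    have "reach (M - N) b a"
      using reach_trans[OF reach_trans[OF ab(4) reach_arc[OF assms(1)]] ab(2)] .
    then have "reach (M - N) a b" using rev[OF ab(3,1)] by simp
    then show False using no reach_trans[OF ab(2) reach_trans[OF _ ab(4)]] by simp
  qed
qed

text \<open>No arc leaves the set reachable from \<open>head G f\<close>, so by balance none enters
  it; if \<open>tail G f\<close> lay outside, \<open>f\<close> would enter.\<close>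

lemma balanced_reach:
  assumes "balanced E" "f \<in> E"
  shows "reach E (head G f) (tail G f)"
proof (rule ccontr)
  assume no: "\<not> ?thesis"
  define Z where "Z = {y. reach E (head G f) y}"
  have "cut E (- Z) \<lesssim> cut E (- (- Z))" using assms(1) unfolding balanced_def by blast
  then have "cut E (- Z) = {}"
    using cut_reachable_set[of E "head G f"] by (simp add: Z_def)
  moreover have "f \<in> cut E (- Z)" using assms(2) no by (simp add: cut_def Z_def)
  ultimately show False by simp
qed

section \<open>Finite Eulerian arc sets and exhaustion by them\<close>

lemma finite_cut: "finite E \<Longrightarrow> finite (cut E X)"
  by (simp add: cut_def)

lemma cut_mono: "E \<subseteq> E' \<Longrightarrow> cut E X \<subseteq> cut E' X"
  by (auto simp: cut_def)

lemma cut_Diff: "cut (E - K) X = cut E X - cut K X"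
  by (auto simp: cut_def)

lemma cut_Un: "cut (E \<union> K) X = cut E X \<union> cut K X"
  by (auto simp: cut_def)

lemma eulerian_empty: "eulerian {}"
  by (simp add: eulerian_def cut_def)

lemma eulerian_balanced: "eulerian K \<Longrightarrow> balanced K"
  unfolding balanced_def eulerian_def by (simp add: lepoll_iff_card_le finite_cut)

lemma eulerian_Diff:
  assumes "eulerian K'" "eulerian K" "K \<subseteq> K'"
  shows "eulerian (K' - K)"
  using assms cut_mono[OF assms(3)]
  unfolding eulerian_def by (simp add: cut_Diff card_Diff_subset finite_cut)

lemma eulerian_Un:
  assumes "eulerian K'" "eulerian K" "K \<inter> K' = {}"
  shows "eulerian (K \<union> K')"
proof -
  have "card (cut (K \<union> K') X) = card (cut K X) + card (cut K' X)" for X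
    unfolding cut_Un using assms
    by (intro card_Un_disjoint) (auto simp: eulerian_def finite_cut, auto simp: cut_def)
  then show ?thesis using assms unfolding eulerian_def by simp
qed

text \<open>Finite cuts lose equally many arcs on both sides. Infinite cuts keep their cardinality
  when finitely many arcs are removed.\<close>

lemma balanced_Diff_eulerian:
  assumes E: "balanced E" and K: "eulerian K" "K \<subseteq> E"
  shows "balanced (E - K)"
  unfolding balanced_def
proof
  fix X
  have le: "cut E X \<lesssim> cut E (- X)" for X using E unfolding balanced_def by blast
  have sub: "cut K X \<subseteq> cut E X" for X using K(2) by (rule cut_mono)
  have fin: "finite (cut K X)" for X using K(1) by (simp add: eulerian_def finite_cut)
  show "cut (E - K) X \<lesssim> cut (E - K) (- X)"
  proof (cases "finite (cut E (- X))")
    case True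
    then have finX: "finite (cut E X)" using le[of X] lepoll_iff_finite_card
      by (meson eqpoll_finite_iff lepoll_def inj_on_finite)
    have "card (cut E X) \<le> card (cut E (- X))"
      using le[of X] lepoll_iff_card_le[OF finX True] by blast
    moreover have "card (cut K X) = card (cut K (- X))" using K(1) by (simp add: eulerian_def)
    ultimately show ?thesis
      using True finX fin sub by (simp add: cut_Diff lepoll_iff_card_le card_Diff_subset)
  next
    case False
    then have inf: "infinite (cut (E - K) (- X))" using fin by (simp add: cut_Diff)
    have "cut (E - K) X \<lesssim> cut E X" by (simp add: cut_Diff subset_imp_lepoll Diff_subset)
    also have "cut E X \<lesssim> cut E (- X)" by (rule le)
    also have "cut E (- X) = cut (E - K) (- X) \<union> cut K (- X)" using sub by (auto simp: cut_Diff)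
    also have "\<dots> \<lesssim> cut (E - K) (- X)"
      using inf fin finite_lepoll_infinite by (intro Un_lepoll) auto
    finally show ?thesis .
  qed
qed

text \<open>Enclose \<open>K\<close> and \<open>f\<close> in a finite Eulerian \<open>K'\<close>
  inside \<open>E\<close>; then \<open>K' - K\<close> is Eulerian, contains \<open>f\<close>, and
  supplies the return walk.\<close>

lemma finitely_eulerian_reach:
  assumes "finitely_eulerian E" "eulerian K" "K \<subseteq> E" "f \<in> E - K"
  shows "reach (E - K) (head G f) (tail G f)"
proof -
  have "finite (insert f K)" "insert f K \<subseteq> E" using assms by (auto simp: eulerian_def)
  then obtain K' where K': "eulerian K'" "insert f K \<subseteq> K'" "K' \<subseteq> E"
    using assms(1) unfolding finitely_eulerian_def by blast
  then have "eulerian (K' - K)" using eulerian_Diff assms by blast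
  then have "reach (K' - K) (head G f) (tail G f)"
    using balanced_reach[OF eulerian_balanced] K'(2) assms(4) by blast
  then show ?thesis by (rule reach_mono) (use K' in blast)
qed

text \<open>If more arcs left \<open>X\<close> than the finite number entering it, a finite Eulerian
  set around sufficiently many of them would be unbalanced. Hence balance can fail only where
  \<open>cut E (- X)\<close> is infinite.\<close>

lemma finitely_eulerian_cut:
  assumes "finitely_eulerian E" "finite (cut E (- X))"
  shows "cut E X \<lesssim> cut E (- X)"
proof (rule ccontr)
  assume no: "\<not> ?thesis"
  have "\<exists>F\<subseteq>cut E X. finite F \<and> card F > card (cut E (- X))"
  proof (cases "finite (cut E X)")
    case True
    then have "card (cut E (- X)) < card (cut E X)"
      using no lepoll_iff_card_le[OF True assms(2)] by simp
    then show ?thesis using True by (intro exI[of _ "cut E X"]) simp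
  next
    case False
    then show ?thesis
      using infinite_arbitrarily_large[of "cut E X" "Suc (card (cut E (- X)))"] by (metis lessI)
  qed
  then obtain F where F: "F \<subseteq> cut E X" "finite F" "card F > card (cut E (- X))" by blast
  moreover have "F \<subseteq> E" using F(1) unfolding cut_def by blast
  ultimately obtain K where K: "eulerian K" "F \<subseteq> K" "K \<subseteq> E"
    using assms(1) unfolding finitely_eulerian_def by blast
  have "F \<subseteq> cut K X" using F(1) K(2) unfolding cut_def by blast
  then have "card F \<le> card (cut K X)"
    using K(1) by (intro card_mono) (simp_all add: eulerian_def finite_cut)
  also have "\<dots> = card (cut K (- X))" using K(1) by (simp add: eulerian_def)
  also have "\<dots> \<le> card (cut E (- X))" using assms(2) cut_mono[OF K(3)] by (intro card_mono)
  finally show False using F(3) by simp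
qed

lemma decomposable_UN:
  assumes "\<And>i. i \<in> I \<Longrightarrow> decomposable (A i)"
    and "\<And>i j. i \<in> I \<Longrightarrow> j \<in> I \<Longrightarrow> i \<noteq> j \<Longrightarrow> A i \<inter> A j = {}"
  shows "decomposable (\<Union>i\<in>I. A i)"
proof -
  obtain P where P: "\<And>i. i \<in> I \<Longrightarrow> partition_on (A i) (P i)"
    "\<And>i C. i \<in> I \<Longrightarrow> C \<in> P i \<Longrightarrow> dicycle_arcs G C"
    using assms(1) unfolding decomposable_def by metis
  have PU: "\<Union> (P i) = A i" and PD: "disjoint (P i)" and PE: "{} \<notin> P i" if "i \<in> I" for i
    using P(1)[OF that] by (simp_all add: partition_on_def)
  have "partition_on (\<Union>i\<in>I. A i) (\<Union>i\<in>I. P i)"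
    unfolding partition_on_def
  proof (intro conjI disjointI)
    have "(\<Union>i\<in>I. A i) = (\<Union>i\<in>I. \<Union> (P i))" using PU by simp
    then show "\<Union> (\<Union>i\<in>I. P i) = (\<Union>i\<in>I. A i)" by blast
    show "{} \<notin> (\<Union>i\<in>I. P i)" using PE by auto
    fix p q assume "p \<in> (\<Union>i\<in>I. P i)" "q \<in> (\<Union>i\<in>I. P i)" and pq: "p \<noteq> q"
    then obtain i j where ij: "i \<in> I" "j \<in> I" "p \<in> P i" "q \<in> P j" by auto
    show "p \<inter> q = {}"
    proof (cases "i = j")
      case True
      then show ?thesis using disjointD[OF PD[OF ij(1)]] ij pq by simp
    next
      case False
      moreover have "p \<subseteq> A i" "q \<subseteq> A j"
        using PU[OF ij(1)] PU[OF ij(2)] ij(3,4) by auto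
      ultimately show ?thesis using assms(2)[OF ij(1,2)] by auto
    qed
  qed
  then show ?thesis unfolding decomposable_def using P(2) by blast
qed

end

section \<open>Directed cycles\<close>

context wf_digraph
begin

lemma dicycle_eulerian:
  assumes "dicycle_arcs G C"
  shows "eulerian C"
proof -
  obtain p u where p: "C = set p" "awalk u p u" "distinct p"
    using assms unfolding dicycle_arcs_def cycle_conv by blast
  \<comment> \<open>Along a walk, exits from \<open>X\<close> minus entries into \<open>X\<close>
    depend only on the two endpoints. For a closed walk they cancel, and distinctness of
    \<open>p\<close> turns list lengths into cardinalities.\<close>
  have count: "length (filter (\<lambda>e. tail G e \<in> X \<and> head G e \<notin> X) p) + of_bool (v \<in> X)
      = length (filter (\<lambda>e. tail G e \<notin> X \<and> head G e \<in> X) p) + of_bool (u \<in> X)"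
    if "cas u p v" for X u v p
    using that by (induction u p v rule: cas.induct) auto
  have "card (cut C X) = card (cut C (- X))" for X
    using count[of u p u X] p distinct_card[of "filter Q p" for Q]
    unfolding cut_def awalk_def by (simp add: Int_def flip: set_filter)
  then show ?thesis unfolding eulerian_def using p(1) by simp
qed

lemma reach_imp_dicycle:
  assumes "f \<in> E" "E \<subseteq> arcs G" "reach E (head G f) (tail G f)"
  obtains C where "dicycle_arcs G C" "f \<in> C" "C \<subseteq> E"
proof -
  have walk: "\<exists>p. awalk x p y \<and> set p \<subseteq> E" if "reach E x y" "y \<in> verts G" for x y
    using that(1)
  proof (induction rule: converse_reach_induct)
    case refl
    then show ?case using that(2) by (intro exI[of _ "[]"]) (simp add: awalk_Nil_iff)
  next
    case (step e)
    then obtain p where "awalk (head G e) p y" "set p \<subseteq> E" by blast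
    then show ?case using step(1) assms(2)
      by (intro exI[of _ "e # p"]) (auto simp: awalk_Cons_iff)
  qed
  have "tail G f \<in> verts G" using assms(1,2) wellformed by blast
  then obtain q where q: "awalk (head G f) q (tail G f)" "set q \<subseteq> E"
    using walk[OF assms(3)] by blast
  \<comment> \<open>Passing to a path removes repeated vertices, so that prefixing \<open>f\<close>
    gives a cycle; for a loop the path is empty.\<close>
  define p where "p = awalk_to_apath q"
  have "apath (head G f) p (tail G f)" "set p \<subseteq> E"
    using q apath_awalk_to_apath[OF q(1)] awalk_to_apath_subset[OF q(1)] unfolding p_def by auto
  then have "cycle (f # p)" "set (f # p) \<subseteq> E"
    using assms(1,2) unfolding cycle_def apath_def
    by (auto simp: awalk_Cons_iff intro!: exI[of _ "tail G f"])
  then show thesis using that[of "set (f # p)"] unfolding dicycle_arcs_def by force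
qed

text \<open>Absorb the arcs of \<open>F\<close> one at a time: an arc not yet in the Eulerian set
  \<open>K\<close> lies on a cycle disjoint from \<open>K\<close>, and adding that cycle keeps the
  set Eulerian.\<close>

lemma finitely_eulerianI:
  assumes "E \<subseteq> arcs G"
    and "\<And>K f. eulerian K \<Longrightarrow> K \<subseteq> E \<Longrightarrow> f \<in> E - K \<Longrightarrow> reach (E - K) (head G f) (tail G f)"
  shows "finitely_eulerian E"
  unfolding finitely_eulerian_def
proof (intro allI impI)
  fix F assume "finite F" "F \<subseteq> E"
  then show "\<exists>K. eulerian K \<and> F \<subseteq> K \<and> K \<subseteq> E"
  proof (induction F rule: finite_induct)
    case empty
    then show ?case using eulerian_empty by blast
  next
    case (insert f F)
    then obtain K where K: "eulerian K" "F \<subseteq> K" "K \<subseteq> E" by blast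
    show ?case
    proof (cases "f \<in> K")
      case False
      then have f: "f \<in> E - K" using insert.prems by blast
      obtain C where C: "dicycle_arcs G C" "f \<in> C" "C \<subseteq> E - K"
        using reach_imp_dicycle[OF f _ assms(2)[OF K(1,3) f]] assms(1) by blast
      then have "eulerian (K \<union> C)"
        using K(1) dicycle_eulerian by (intro eulerian_Un) auto
      then show ?thesis using C K by (intro exI[of _ "K \<union> C"]) auto
    qed (use K in blast)
  qed
qed

lemma balanced_finitely_eulerian:
  assumes "E \<subseteq> arcs G" "balanced E"
  shows "finitely_eulerian E"
  using assms(1) balanced_reach[OF balanced_Diff_eulerian[OF assms(2)]]
  by (intro finitely_eulerianI)

lemma eulerian_decomposable:
  assumes "eulerian K" "K \<subseteq> arcs G"
  shows "decomposable K"
  using assms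
proof (induction "card K" arbitrary: K rule: less_induct)
  case less
  show ?case
  proof (cases "K = {}")
    case True
    then show ?thesis
      unfolding decomposable_def by (intro exI[of _ "{}"]) (simp add: partition_on_def)
  next
    case False
    then obtain f where f: "f \<in> K" by blast
    obtain C where C: "dicycle_arcs G C" "f \<in> C" "C \<subseteq> K"
      using reach_imp_dicycle[OF f less.prems(2) balanced_reach[OF eulerian_balanced[OF less.prems(1)] f]] .
    have "eulerian (K - C)" using eulerian_Diff less.prems(1) C dicycle_eulerian by blast
    moreover have "card (K - C) < card K"
      using C less.prems(1) f by (intro psubset_card_mono) (auto simp: eulerian_def)
    ultimately have rest: "decomposable (K - C)"
      using less.hyps[of "K - C"] less.prems(2) by blast
    have "decomposable C"
      unfolding decomposable_def using C(1,2)
      by (intro exI[of _ "{C}"]) (auto simp: partition_on_def)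
    then have "decomposable (\<Union>b. if b then C else K - C)"
      using rest by (intro decomposable_UN) auto
    also have "(\<Union>b. if b then C else K - C) = K"
      using C(3) by (auto split: if_splits)
    finally show ?thesis .
  qed
qed

text \<open>Along an enumeration, build an increasing sequence of finite Eulerian sets exhausting
  \<open>E\<close>. Successive differences are Eulerian, hence decomposable, and they partition
  \<open>E\<close>.\<close>

lemma countable_decomposable:
  assumes "finitely_eulerian E" "E \<subseteq> arcs G" "countable E"
  shows "decomposable E"
proof (cases "E = {}")
  case True
  then show ?thesis using eulerian_decomposable eulerian_empty by simp
next
  case False
  define e where "e = from_nat_into E"
  have e: "range e = E" unfolding e_def using False assms(3) by (rule range_from_nat_into)
  obtain env where env: "\<And>F. finite F \<Longrightarrow> F \<subseteq> E \<Longrightarrow> eulerian (env F) \<and> F \<subseteq> env F \<and> env F \<subseteq> E"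
    using assms(1) unfolding finitely_eulerian_def by metis
  define K where "K = rec_nat {} (\<lambda>n K. env (insert (e n) K))"
  have K0: "K 0 = {}" and KS: "K (Suc n) = env (insert (e n) (K n))" for n
    by (simp_all add: K_def)
  have K: "eulerian (K n) \<and> K n \<subseteq> E" for n
  proof (induction n)
    case (Suc n)
    then have "finite (insert (e n) (K n))" "insert (e n) (K n) \<subseteq> E"
      using e by (auto simp: eulerian_def)
    then show ?case using env KS by simp
  qed (simp add: K0 eulerian_empty)
  have step: "insert (e n) (K n) \<subseteq> K (Suc n)" for n
  proof -
    have "finite (insert (e n) (K n))" "insert (e n) (K n) \<subseteq> E"
      using e K[of n] by (auto simp: eulerian_def)
    then show ?thesis using env[of "insert (e n) (K n)"] unfolding KS by simp
  qed
  have mono: "K m \<subseteq> K n" if "m \<le> n" for m n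
    using lift_Suc_mono_le[of K m n] step that by simp
  have "E = (\<Union>n. K (Suc n) - K n)"
  proof
    show "(\<Union>n. K (Suc n) - K n) \<subseteq> E" using K by auto
    show "E \<subseteq> (\<Union>n. K (Suc n) - K n)"
    proof
      fix x assume "x \<in> E"
      then obtain n where "x = e n" using e by auto
      then have "x \<in> K (Suc n)" using step[of n] by simp
      then obtain m where m: "x \<in> K (Suc m)" "\<And>k. k < m \<Longrightarrow> x \<notin> K (Suc k)"
        using exists_least_iff[of "\<lambda>n. x \<in> K (Suc n)"] by blast
      then have "x \<notin> K m" using K0 by (cases m) auto
      then show "x \<in> (\<Union>n. K (Suc n) - K n)" using m(1) by blast
    qed
  qed
  moreover have "decomposable (\<Union>n. K (Suc n) - K n)"
  proof (rule decomposable_UN)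
    show "decomposable (K (Suc n) - K n)" for n
      using K eulerian_Diff[of "K (Suc n)" "K n"] step assms(2)
      by (intro eulerian_decomposable) blast+
    show "(K (Suc i) - K i) \<inter> (K (Suc j) - K j) = {}" if "i \<noteq> j" for i j :: nat
      using that mono[of "Suc i" j] mono[of "Suc j" i] by (cases "i < j") auto
  qed
  ultimately show ?thesis by simp
qed

end

section \<open>Separators, disjoint walks and closed arc sets\<close>

locale segmented_digraph = wf_digraph G + initial_segments E seg
  for G :: "('a, 'b) pre_digraph" and E :: "'b set" and seg :: "'b \<Rightarrow> 'b set" +
  assumes arcs_E: "E \<subseteq> arcs G" and balanced_E: "balanced E"
begin

text \<open>One enumeration serves all sizes at once: take the least \<open>c\<close> such that some
  separator has size at most that of \<open>seg c\<close>, and let \<open>j\<close> enumerate such a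
  separator along \<open>seg c\<close>. Any other admissible segment contains \<open>seg c\<close>,
  so its image contains the same separator.\<close>

lemma enumerated_separator_exists:
  "\<exists>j. \<forall>a S. a \<in> E \<longrightarrow> S \<lesssim> seg a \<longrightarrow> \<not> reach (E - S) x y \<longrightarrow> \<not> reach (E - j ` seg a) x y"
proof (cases "\<exists>a\<in>E. \<exists>S. S \<lesssim> seg a \<and> \<not> reach (E - S) x y")
  case True
  then obtain a where a: "a \<in> E" "\<exists>S. S \<lesssim> seg a \<and> \<not> reach (E - S) x y" by blast
  obtain c where c: "c \<in> E" "\<exists>S. S \<lesssim> seg c \<and> \<not> reach (E - S) x y"
    and least: "\<And>d. d \<in> E \<Longrightarrow> \<exists>S. S \<lesssim> seg d \<and> \<not> reach (E - S) x y \<Longrightarrow> d \<notin> seg c"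
    by (rule least_exists[of a "\<lambda>a. \<exists>S. S \<lesssim> seg a \<and> \<not> reach (E - S) x y", OF a]) blast
  obtain S j where S: "\<not> reach (E - S) x y" "S \<subseteq> j ` seg c"
    using c(2) unfolding lepoll_iff by blast
  have "\<not> reach (E - j ` seg d) x y" if "d \<in> E" "T \<lesssim> seg d" "\<not> reach (E - T) x y" for d T
  proof
    assume r: "reach (E - j ` seg d) x y"
    have "d \<notin> seg c" using least[OF that(1)] that(2,3) by auto
    then have "seg c \<subseteq> seg d" using seg_mono_iff c(1) that(1) by simp
    then have "S \<subseteq> j ` seg d" using S(2) image_mono[of "seg c" "seg d" j] by simp
    then have "reach (E - S) x y" using reach_mono[OF r, of "E - S"] by auto
    then show False using S(1) by simp
  qed
  then show ?thesis by blast
qed blast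

text \<open>Walks are chosen by recursion along the lexicographic order, each avoiding all earlier
  ones. The second index gives every \<open>a\<close> a whole block of walks, so that many disjoint
  walks share the first index \<open>a\<close>.\<close>

lemma disjoint_walks_exist:
  "\<exists>p. (\<forall>i. finite (p i) \<and> p i \<subseteq> E) \<and> (\<forall>i j. i \<noteq> j \<longrightarrow> p i \<inter> p j = {}) \<and>
    (\<forall>a b. p (a, b) \<noteq> {} \<longrightarrow> a \<in> E) \<and>
    (\<forall>a b S. a \<in> E \<longrightarrow> b \<in> insert a (seg a) \<longrightarrow> infinite S \<longrightarrow> seg a \<lesssim> S \<longrightarrow>
      linked E S x y \<longrightarrow> reach (p (a, b)) x y)"
proof -
  define W where "W = {(b, a). b \<in> seg a}"
  define R where "R = W <*lex*> W"
  define D where "D = {(a, b). a \<in> E \<and> b \<in> insert a (seg a)}"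
  define U where "U f i = (\<Union>j\<in>{j \<in> D. (j, i) \<in> R}. f j)" for f :: "'b \<times> 'b \<Rightarrow> 'b set" and i
  \<comment> \<open>A connecting set is demanded only if one remains; otherwise the empty set
    qualifies, so the recursion never gets stuck.\<close>
  define P where "P f i r \<longleftrightarrow> finite r \<and> r \<subseteq> E - U f i \<and> (i \<notin> D \<longrightarrow> r = {}) \<and>
    (i \<in> D \<longrightarrow> reach (E - U f i) x y \<longrightarrow> reach r x y)" for f i r
  have "\<exists>p. \<forall>i. P p i (p i)"
  proof (rule dependent_wf_choice)
    show "wf R" unfolding R_def W_def using seg_wf by (intro wf_lex_prod)
    show "P f i r = P g i r" if "\<And>j. (j, i) \<in> R \<Longrightarrow> f j = g j" for f g i r
    proof -
      have "U f i = U g i" unfolding U_def using that by (intro SUP_cong) auto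
      then show ?thesis unfolding P_def by simp
    qed
    show "\<exists>r. P f i r" for f i
    proof (cases "i \<in> D \<and> reach (E - U f i) x y")
      case True
      then obtain r where "r \<subseteq> E - U f i" "finite r" "reach r x y"
        using reach_finite_subset by blast
      then show ?thesis unfolding P_def using True by blast
    next
      case False
      then show ?thesis unfolding P_def by (intro exI[of _ "{}"]) auto
    qed
  qed
  then obtain p where p: "\<And>i. P p i (p i)" by blast
  have earlier: "p i \<inter> p j = {}" if "i \<in> D" "(i, j) \<in> R" for i j
  proof -
    have "p i \<subseteq> U p j" unfolding U_def using that by blast
    then show ?thesis using p[of j] unfolding P_def by blast
  qed
  have disj: "p i \<inter> p j = {}" if "i \<noteq> j" for i j
  proof (cases "i \<in> D \<and> j \<in> D")
    case True
    obtain a b c d where ij: "i = (a, b)" "j = (c, d)" by fastforce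
    have "b \<in> E" "d \<in> E" using True ij seg_subset unfolding D_def by auto
    then have "(i, j) \<in> R \<or> (j, i) \<in> R"
      using True ij that seg_linear[of a c] seg_linear[of b d] unfolding R_def W_def D_def by auto
    then show ?thesis using earlier True by (metis Int_commute)
  next
    case False
    then show ?thesis using p[of i] p[of j] unfolding P_def by blast
  qed
  have walk: "reach (p (a, b)) x y"
    if ab: "a \<in> E" "b \<in> insert a (seg a)" and S: "infinite S" "seg a \<lesssim> S" "linked E S x y" for a b S
  proof -
    let ?J = "{j \<in> D. (j, (a, b)) \<in> R}"
    \<comment> \<open>The predecessors of \<open>(a, b)\<close> lie in a square of size at most that
      of the infinite \<open>S\<close>. The earlier walks are finite, so together they use at most
      that many arcs, which linkage tolerates.\<close>
    have sub: "?J \<subseteq> insert a (seg a) \<times> insert a (seg a)"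
      unfolding D_def R_def W_def using seg_trans by auto
    have ins: "insert a (seg a) \<lesssim> S"
      using Un_lepoll[OF S(1) _ S(2), of "{a}"] finite_lepoll_infinite[OF S(1), of "{a}"] by simp
    have J: "?J \<lesssim> S"
      by (rule lepoll_trans[OF subset_imp_lepoll[OF sub] times_lepoll[OF S(1) ins ins]])
    have "finite (p j)" for j using p[of j] by (simp add: P_def)
    then have "U p (a, b) \<lesssim> S"
      unfolding U_def by (intro UN_lepoll[OF S(1) J] finite_lepoll_infinite[OF S(1)])
    then have "reach (E - U p (a, b)) x y" using S(3) by (simp add: linked_def)
    moreover have "(a, b) \<in> D" using ab by (simp add: D_def)
    ultimately show ?thesis using p[of "(a, b)"] by (simp add: P_def)
  qed
  have "finite (p i) \<and> p i \<subseteq> E" for i using p[of i] by (auto simp: P_def)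
  moreover have "a \<in> E" if "p (a, b) \<noteq> {}" for a b
    using p[of "(a, b)"] that by (auto simp: P_def D_def)
  ultimately show ?thesis using disj walk by (intro exI[of _ p]) simp
qed

definition sep :: "'a \<Rightarrow> 'a \<Rightarrow> 'b \<Rightarrow> 'b" where
  "sep x y = (SOME j. \<forall>a S. a \<in> E \<longrightarrow> S \<lesssim> seg a \<longrightarrow> \<not> reach (E - S) x y \<longrightarrow>
    \<not> reach (E - j ` seg a) x y)"

definition walks :: "'a \<Rightarrow> 'a \<Rightarrow> 'b \<times> 'b \<Rightarrow> 'b set" where
  "walks x y = (SOME p. (\<forall>i. finite (p i) \<and> p i \<subseteq> E) \<and> (\<forall>i j. i \<noteq> j \<longrightarrow> p i \<inter> p j = {}) \<and>
    (\<forall>a b. p (a, b) \<noteq> {} \<longrightarrow> a \<in> E) \<and>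
    (\<forall>a b S. a \<in> E \<longrightarrow> b \<in> insert a (seg a) \<longrightarrow> infinite S \<longrightarrow> seg a \<lesssim> S \<longrightarrow>
      linked E S x y \<longrightarrow> reach (p (a, b)) x y))"

text \<open>Intersecting with \<open>E\<close> gives a finite Eulerian value for every finite
  \<open>F\<close>, as the size bound on closures requires.\<close>

definition env :: "'b set \<Rightarrow> 'b set" where
  "env F = (SOME K. eulerian K \<and> F \<inter> E \<subseteq> K \<and> K \<subseteq> E)"

lemma sep_separates:
  "a \<in> E \<Longrightarrow> S \<lesssim> seg a \<Longrightarrow> \<not> reach (E - S) x y \<Longrightarrow> \<not> reach (E - sep x y ` seg a) x y"
  using someI_ex[OF enumerated_separator_exists[of x y]] unfolding sep_def by blast

lemma
  shows finite_walks: "finite (walks x y i)" and walks_subset: "walks x y i \<subseteq> E"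
    and walks_disjoint: "i \<noteq> j \<Longrightarrow> walks x y i \<inter> walks x y j = {}"
    and walks_index: "walks x y (a, b) \<noteq> {} \<Longrightarrow> a \<in> E"
    and reach_walks: "a \<in> E \<Longrightarrow> b \<in> insert a (seg a) \<Longrightarrow> infinite S \<Longrightarrow> seg a \<lesssim> S \<Longrightarrow>
      linked E S x y \<Longrightarrow> reach (walks x y (a, b)) x y"
proof -
  note spec = someI_ex[OF disjoint_walks_exist[of x y], folded walks_def]
  show "finite (walks x y i)" "walks x y i \<subseteq> E" using spec[THEN conjunct1] by blast+
  show "walks x y i \<inter> walks x y j = {}" if "i \<noteq> j"
    using spec[THEN conjunct2, THEN conjunct1] that by blast
  show "a \<in> E" if "walks x y (a, b) \<noteq> {}"
    using spec[THEN conjunct2, THEN conjunct2, THEN conjunct1] that by blast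
  show "reach (walks x y (a, b)) x y"
    if "a \<in> E" "b \<in> insert a (seg a)" "infinite S" "seg a \<lesssim> S" "linked E S x y"
    using spec[THEN conjunct2, THEN conjunct2, THEN conjunct2] that by blast
qed

lemma
  assumes "finite F"
  shows eulerian_env: "eulerian (env F)" and subset_env: "F \<inter> E \<subseteq> env F" and env_subset: "env F \<subseteq> E"
proof -
  have "\<exists>K. eulerian K \<and> F \<inter> E \<subseteq> K \<and> K \<subseteq> E"
    using balanced_finitely_eulerian[OF arcs_E balanced_E] assms
    unfolding finitely_eulerian_def by simp
  from someI_ex[OF this]
  show "eulerian (env F)" "F \<inter> E \<subseteq> env F" "env F \<subseteq> E"
    unfolding env_def[symmetric] by auto
qed

text \<open>The last clause of \<open>gen\<close> makes a closed set that meets a walk contain the first component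
  of its index: the walks indexed by \<open>(a, b)\<close> with \<open>a \<notin> N\<close> avoid the closed set \<open>N\<close>.\<close>

definition gen :: "'b set \<Rightarrow> 'b set" where
  "gen F = E \<inter> (env F \<union> (\<Union>x\<in>ends F. \<Union>y\<in>ends F. sep x y ` F \<union>
    (\<Union>a\<in>F. \<Union>b\<in>F. walks x y (a, b)) \<union> {a. \<exists>b. walks x y (a, b) \<inter> F \<noteq> {}}))"

lemma finite_gen:
  assumes "finite F"
  shows "finite (gen F)"
proof -
  \<comment> \<open>By disjointness each arc lies in at most one walk of the family, so a finite
    \<open>F\<close> meets finitely many.\<close>
  have "finite {a. \<exists>b. walks x y (a, b) \<inter> F \<noteq> {}}" for x y
  proof -
    have "finite {i. e \<in> walks x y i}" for e
    proof (cases "{i. e \<in> walks x y i} = {}")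
      case True
      then show ?thesis by (simp only: finite.emptyI)
    next
      case False
      then obtain i where "e \<in> walks x y i" by auto
      then have "{i. e \<in> walks x y i} \<subseteq> {i}" using walks_disjoint[of _ i x y] by auto
      then show ?thesis by (rule finite_subset) simp
    qed
    then have "finite (fst ` (\<Union>e\<in>F. {i. e \<in> walks x y i}))" using assms by simp
    then show ?thesis by (rule rev_finite_subset) force
  qed
  moreover have "finite (ends F)" using assms by (simp add: ends_def)
  moreover have "finite (env F)" using eulerian_env[OF assms] by (simp add: eulerian_def)
  ultimately show ?thesis unfolding gen_def using assms finite_walks by simp
qed

lemma gen_subset: "gen F \<subseteq> E"
  unfolding gen_def by simp

lemma closure_gen_subset: "S \<subseteq> E \<Longrightarrow> closure_under gen S \<subseteq> E"
  using gen_subset by (intro closure_under_least) (auto simp: closed_under_def)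

lemma endsE:
  assumes "x \<in> ends N"
  obtains e where "e \<in> N" "x \<in> ends {e}"
  using assms unfolding ends_def by auto

lemma ends_mono: "N \<subseteq> N' \<Longrightarrow> ends N \<subseteq> ends N'"
  unfolding ends_def by auto

lemma closed_finitely_eulerian:
  assumes "closed_under gen N" "N \<subseteq> E"
  shows "finitely_eulerian N"
  unfolding finitely_eulerian_def
proof (intro allI impI)
  fix F assume F: "finite F" "F \<subseteq> N"
  have "env F \<subseteq> gen F" using env_subset[OF F(1)] unfolding gen_def by simp
  also have "gen F \<subseteq> N" using assms(1) F unfolding closed_under_def by simp
  finally show "\<exists>K. eulerian K \<and> F \<subseteq> K \<and> K \<subseteq> N"
    using eulerian_env[OF F(1)] subset_env[OF F(1)] F(2) assms(2) by blast
qed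

lemma closed_under_genD:
  assumes N: "closed_under gen N" and xy: "x \<in> ends N" "y \<in> ends N" and F: "finite F" "F \<subseteq> N"
  shows "E \<inter> sep x y ` F \<subseteq> N"
    and "a \<in> F \<Longrightarrow> b \<in> F \<Longrightarrow> walks x y (a, b) \<subseteq> N"
    and "walks x y (a, b) \<inter> F \<noteq> {} \<Longrightarrow> a \<in> N"
proof -
  obtain e f where ef: "e \<in> N" "x \<in> ends {e}" "f \<in> N" "y \<in> ends {f}"
    using xy endsE by metis
  \<comment> \<open>The vertices \<open>x\<close> and \<open>y\<close> are ends of \<open>N\<close>
    but perhaps not of \<open>F\<close>; two witnessing arcs are added so that \<open>gen\<close>
    sees them.\<close>
  define F' where "F' = insert e (insert f F)"
  have F': "finite F'" "F' \<subseteq> N" "F \<subseteq> F'" using F ef by (auto simp: F'_def)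
  have xy': "x \<in> ends F'" "y \<in> ends F'" using ef by (auto simp: F'_def ends_def)
  have sub: "z \<in> N"
    if "z \<in> E" "z \<in> sep x y ` F' \<union> (\<Union>a\<in>F'. \<Union>b\<in>F'. walks x y (a, b)) \<union>
      {a. \<exists>b. walks x y (a, b) \<inter> F' \<noteq> {}}" for z
  proof -
    have "z \<in> gen F'"
      unfolding gen_def using that(1) by (intro IntI UnI2 UN_I[OF xy'(1)] UN_I[OF xy'(2)] that(2))
    then show ?thesis using N F' unfolding closed_under_def by auto
  qed
  show "E \<inter> sep x y ` F \<subseteq> N"
  proof
    fix z assume "z \<in> E \<inter> sep x y ` F"
    then show "z \<in> N" using F'(3) by (intro sub) auto
  qed
  show "walks x y (a, b) \<subseteq> N" if "a \<in> F" "b \<in> F"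
  proof
    fix z assume z: "z \<in> walks x y (a, b)"
    have "a \<in> F'" "b \<in> F'" using that F'(3) by auto
    then show "z \<in> N" using z walks_subset[of x y "(a, b)"] by (intro sub) auto
  qed
  show "a \<in> N" if ab: "walks x y (a, b) \<inter> F \<noteq> {}"
  proof (rule sub)
    show "a \<in> E" using ab by (intro walks_index[of x y a b]) auto
    have "walks x y (a, b) \<inter> F' \<noteq> {}" using ab F'(3) by auto
    then show "a \<in> sep x y ` F' \<union> (\<Union>a\<in>F'. \<Union>b\<in>F'. walks x y (a, b)) \<union>
      {a. \<exists>b. walks x y (a, b) \<inter> F' \<noteq> {}}" by auto
  qed
qed

lemma closed_sep: 
  assumes "closed_under gen N" "x \<in> ends N" "y \<in> ends N" "S \<subseteq> N"
  shows "E \<inter> sep x y ` S \<subseteq> N"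
  using closed_under_genD(1)[OF assms(1-3), of "{s}" for s] assms(4) by auto

lemma closed_walks:
  assumes "closed_under gen N" "x \<in> ends N" "y \<in> ends N" "a \<in> N" "b \<in> N"
  shows "walks x y (a, b) \<subseteq> N"
  using closed_under_genD(2)[OF assms(1-3), of "{a, b}"] assms(4,5) by auto

lemma closed_walks_index:
  assumes "closed_under gen N" "x \<in> ends N" "y \<in> ends N" "a \<notin> N"
  shows "walks x y (a, b) \<inter> N = {}"
  using closed_under_genD(3)[OF assms(1-3), of "{e}" a b for e] assms(4) by auto

text \<open>Were there a separator of this size, the one enumerated by \<open>sep u v\<close> on
  \<open>seg a\<close> would separate too. Within \<open>E\<close> it lies in \<open>N\<close>, but
  the given walk avoids \<open>N\<close>.\<close>

lemma closed_linked:
  assumes "closed_under gen N" "u \<in> ends N" "v \<in> ends N" "reach (E - N) u v"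
    and "a \<in> E" "seg a \<subseteq> N"
  shows "linked E (seg a) u v"
  unfolding linked_def
proof (intro allI impI, rule ccontr)
  fix S assume "S \<lesssim> seg a" "\<not> reach (E - S) u v"
  then have "\<not> reach (E - sep u v ` seg a) u v" using sep_separates assms(5) by blast
  moreover have "E - N \<subseteq> E - sep u v ` seg a"
    using closed_sep[OF assms(1-3,6)] by blast
  ultimately show False using reach_mono[OF assms(4)] by blast
qed

section \<open>Balance of \<open>M - N\<close> for a hull \<open>M\<close> and the union
  \<open>N\<close> of earlier hulls\<close>

context
  fixes a M N
  assumes a: "a \<in> E" "infinite (seg a)"
    and M: "closed_under gen M" "M \<subseteq> E" "insert a (seg a) \<subseteq> M" "M \<lesssim> seg a"
    and N: "N \<subseteq> M" "N = {} \<or> closed_under gen N \<and> seg a \<subseteq> N \<and> a \<notin> N"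
begin

text \<open>Symmetry of linkage provides disjoint walks from \<open>v\<close> to \<open>u\<close>
  indexed by \<open>(a, b)\<close> with \<open>b\<close> in \<open>seg a\<close>; they are too many
  for \<open>B\<close> to meet them all. They stay in \<open>M\<close> because both indices do, and
  avoid \<open>N\<close> because \<open>a\<close> does not belong to \<open>N\<close>.\<close>

lemma difference_reverse_reach:
  assumes B: "B \<prec> seg a" and uv: "u \<in> ends N" "v \<in> ends N" "reach (M - B - N) u v"
  shows "reach (M - B - N) v u"
proof -
  have N': "closed_under gen N" "seg a \<subseteq> N" "a \<notin> N" using N(2) uv(1) by (auto simp: ends_def)
  have "reach (E - N) u v" using uv(3) M(2) by (auto elim!: reach_mono)
  then have "linked E (seg a) u v" using closed_linked N' uv a(1) by blast
  then have link: "linked E (seg a) v u" by (rule linked_sym[OF balanced_E])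
  have "\<not> seg a \<lesssim> B" using B by (simp add: not_lepoll_iff)
  then obtain b where b: "b \<in> seg a" "walks v u (a, b) \<inter> B = {}"
    using disjoint_family_avoids[of "seg a" B "\<lambda>b. walks v u (a, b)"] walks_disjoint by blast
  have "walks v u (a, b) \<subseteq> M"
    using closed_walks[OF M(1)] ends_mono[OF N(1)] uv(1,2) M(3) b(1) by blast
  moreover have "walks v u (a, b) \<inter> N = {}"
    using closed_walks_index[OF N'(1)] uv N'(3) by blast
  ultimately have "walks v u (a, b) \<subseteq> M - B - N" using b(2) by blast
  moreover have "reach (walks v u (a, b)) v u"
    using reach_walks[OF a(1) _ a(2) _ link] b(1) by blast
  ultimately show ?thesis using reach_mono by blast
qed

lemma difference_reroute:
  assumes "B \<prec> seg a" "f \<in> M - B - N" "reach (M - B) (head G f) (tail G f)"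
  shows "reach (M - B - N) (head G f) (tail G f)"
  using reroute[OF assms(2,3)] difference_reverse_reach[OF assms(1)] by blast

text \<open>The closed set \<open>M\<close> supplies a return walk for \<open>f\<close> outside a
  finite Eulerian \<open>K\<close>; rerouting with \<open>B\<close> equal to \<open>K\<close> moves
  it outside \<open>N\<close>.\<close>

lemma difference_finitely_eulerian: "finitely_eulerian (M - N)"
proof (rule finitely_eulerianI)
  show "M - N \<subseteq> arcs G" using M(2) arcs_E by blast
  fix K f assume K: "eulerian K" "K \<subseteq> M - N" "f \<in> M - N - K"
  have "reach (M - K) (head G f) (tail G f)"
    using finitely_eulerian_reach[OF closed_finitely_eulerian[OF M(1,2)] K(1)] K by blast
  moreover have "K \<prec> seg a"
    using K(1) by (intro finite_lesspoll_infinite[OF a(2)]) (simp add: eulerian_def)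
  ultimately have "reach (M - K - N) (head G f) (tail G f)"
    using difference_reroute K by blast
  then show "reach (M - N - K) (head G f) (tail G f)" by (rule reach_mono) blast
qed

text \<open>Here linkage is known only up to the size of \<open>N0\<close> itself, so more than that
  many walks are needed. They come from the diagonal indices \<open>(i, i)\<close> with
  \<open>seg i\<close> no larger than \<open>B\<close>, and there are more such \<open>i\<close>
  than elements of \<open>B\<close>.\<close>

lemma closed_hull_reverse_reach:
  assumes B: "infinite B" "B \<prec> seg a" "B \<subseteq> M"
  obtains N0 where "B \<subseteq> N0" "N0 \<lesssim> B" "N0 \<subseteq> M"
    "\<And>u v. u \<in> ends N0 \<Longrightarrow> v \<in> ends N0 \<Longrightarrow> reach (M - N0) u v \<Longrightarrow> reach (M - N0) v u"
proof -
  have not_le: "\<not> seg a \<lesssim> B" using B(2) by (simp add: not_lepoll_iff)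
  \<comment> \<open>A segment of exactly the size of \<open>B\<close> is put into \<open>N0\<close>,
    so that \<open>closed_linked\<close> gives linkage up to that size.\<close>
  obtain c where c: "c \<in> E" "seg c \<approx> B"
    using seg_eqpoll[OF lesspoll_trans[OF B(2) seg_small[OF a(1)]]] by blast
  have "c \<in> seg a"
  proof (rule ccontr)
    assume "c \<notin> seg a"
    then have "seg a \<subseteq> seg c" using seg_mono_iff a(1) c(1) by blast
    then show False
      using lepoll_trans2[OF subset_imp_lepoll c(2)] not_le by simp
  qed
  then have segc: "seg c \<subseteq> M" using seg_mono M(3) by blast
  define N0 where "N0 = closure_under gen (B \<union> seg c)"
  have cl: "closed_under gen N0" unfolding N0_def by (rule closed_closure_under)
  have sub: "B \<subseteq> N0" "seg c \<subseteq> N0" unfolding N0_def using subset_closure_under[of "B \<union> seg c" gen] by blast+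
  have N0M: "N0 \<subseteq> M" unfolding N0_def using B(3) segc M(1) by (intro closure_under_least) auto
  have N0B: "N0 \<lesssim> B"
  proof -
    have "N0 \<lesssim> B \<union> seg c"
      unfolding N0_def using B(1) by (intro closure_under_lepoll finite_gen) auto
    also have "B \<union> seg c \<lesssim> B"
      by (rule Un_lepoll[OF B(1) lepoll_refl eqpoll_imp_lepoll[OF c(2)]])
    finally show ?thesis .
  qed
  define A where "A = {d \<in> seg a. seg d \<lesssim> B}"
  \<comment> \<open>\<open>d\<close> is the first element whose segment exceeds \<open>B\<close>, so
    all elements of \<open>seg d\<close> belong to \<open>A\<close>, which makes \<open>A\<close>
    too large for \<open>N0\<close>.\<close>
  obtain d where d: "d \<in> E" "\<not> seg d \<lesssim> B" "\<And>e. e \<in> E \<Longrightarrow> \<not> seg e \<lesssim> B \<Longrightarrow> e \<notin> seg d" "seg d \<subseteq> seg a"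
    using least_exists[of a "\<lambda>d. \<not> seg d \<lesssim> B", OF a(1) not_le] by blast
  then have "seg d \<subseteq> A" unfolding A_def using seg_subset by blast
  then have "A \<lesssim> N0 \<Longrightarrow> seg d \<lesssim> B"
    by (intro lepoll_trans[OF lepoll_trans[OF subset_imp_lepoll] N0B])
  then have not_A: "\<not> A \<lesssim> N0" using d(2) by blast
  have rev: "reach (M - N0) v u" if uv: "u \<in> ends N0" "v \<in> ends N0" "reach (M - N0) u v" for u v
  proof -
    have "reach (E - N0) u v" using uv(3) M(2) by (auto elim!: reach_mono)
    then have "linked E (seg c) u v" using closed_linked[OF cl] uv c(1) sub by blast
    then have "linked E (seg c) v u" by (rule linked_sym[OF balanced_E])
    then have link: "linked E B v u"
      by (rule linked_mono[OF _ eqpoll_imp_lepoll[OF eqpoll_sym[OF c(2)]]])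
    obtain i where i: "i \<in> A" "walks v u (i, i) \<inter> N0 = {}"
      using disjoint_family_avoids[OF not_A, of "\<lambda>i. walks v u (i, i)"] walks_disjoint by blast
    then have iM: "i \<in> M" "i \<in> E" "seg i \<lesssim> B" using M(2,3) unfolding A_def by auto
    have "walks v u (i, i) \<subseteq> M"
      using closed_walks[OF M(1)] ends_mono[OF N0M] uv iM by blast
    moreover have "reach (walks v u (i, i)) v u"
      using reach_walks[OF iM(2) _ B(1) iM(3) link] by blast
    ultimately show ?thesis using i(2) reach_mono[of "walks v u (i, i)" v u "M - N0"] by blast
  qed
  show thesis using that[OF sub(1) N0B N0M] rev by blast
qed

text \<open>If the arcs \<open>B\<close> entering \<open>X\<close> were fewer than those leaving,
  some leaving arc \<open>f\<close> would lie outside the hull \<open>N0\<close> of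
  \<open>B\<close>. Its return walk in \<open>M\<close> is rerouted twice: first outside
  \<open>N0\<close>, hence outside \<open>B\<close>, then outside \<open>N\<close> while still
  avoiding \<open>B\<close>. Yet it must enter \<open>X\<close>, and so use an arc of
  \<open>B\<close>.\<close>

lemma balanced_difference: "balanced (M - N)"
  unfolding balanced_def
proof (rule allI, rule ccontr)
  fix X
  define B where "B = cut (M - N) (- X)"
  assume no: "\<not> cut (M - N) X \<lesssim> cut (M - N) (- X)"
  then have inf: "infinite B"
    using finitely_eulerian_cut[OF difference_finitely_eulerian] unfolding B_def by blast
  have BM: "B \<subseteq> M" unfolding B_def cut_def by blast
  have "B \<prec> cut (M - N) X" using no unfolding B_def by (simp add: not_lepoll_iff)
  also have "cut (M - N) X \<lesssim> M" by (rule subset_imp_lepoll) (auto simp: cut_def)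
  also have "M \<lesssim> seg a" by (rule M(4))
  finally have small: "B \<prec> seg a" .
  obtain N0 where N0: "B \<subseteq> N0" "N0 \<lesssim> B" "N0 \<subseteq> M"
    "\<And>u v. u \<in> ends N0 \<Longrightarrow> v \<in> ends N0 \<Longrightarrow> reach (M - N0) u v \<Longrightarrow> reach (M - N0) v u"
    using closed_hull_reverse_reach[OF inf small BM] by blast
  have "\<not> cut (M - N) X \<subseteq> N0"
    using no lepoll_trans[OF subset_imp_lepoll[of "cut (M - N) X" N0] N0(2)]
    unfolding B_def by blast
  then obtain f where f: "f \<in> cut (M - N) X" "f \<notin> N0" by blast
  then have fM: "f \<in> M" "f \<notin> N" "tail G f \<in> X" "head G f \<notin> X" by (auto simp: cut_def)
  have "reach M (head G f) (tail G f)"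
    using finitely_eulerian_reach[OF closed_finitely_eulerian[OF M(1,2)] eulerian_empty, of f] fM by simp
  then have "reach (M - N0) (head G f) (tail G f)"
    using reroute[of f M N0] fM(1) f(2) N0(4) by blast
  then have "reach (M - B) (head G f) (tail G f)" by (rule reach_mono) (use N0(1) in blast)
  then have "reach (M - B - N) (head G f) (tail G f)"
    using difference_reroute[OF small, of f] fM f(2) N0(1) by blast
  then have "cut (M - B - N) (- X) \<noteq> {}" by (rule reach_crosses_cut) (use fM in auto)
  then show False unfolding B_def cut_def by blast
qed

end

end

section \<open>Decomposition by induction on the number of arcs\<close>

context segmented_digraph
begin

text \<open>The hull of a finite segment may be infinite; only for infinite segments is the hull
  bounded by the segment.\<close>

definition stages :: "'b set" where
  "stages = {a \<in> E. infinite (seg a)}"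

definition stage_hull :: "'b \<Rightarrow> 'b set" where
  "stage_hull a = closure_under gen (insert a (seg a))"

definition piece :: "'b \<Rightarrow> 'b set" where
  "piece a = stage_hull a - (\<Union>b\<in>stages \<inter> seg a. stage_hull b)"

lemma stage_hull_mono: "b \<in> seg a \<Longrightarrow> stage_hull b \<subseteq> stage_hull a"
  unfolding stage_hull_def using seg_mono[of b a] by (intro closure_under_mono) auto

lemma closed_stage_hull: "closed_under gen (stage_hull a)"
  unfolding stage_hull_def by (rule closed_closure_under)

lemma subset_stage_hull: "insert a (seg a) \<subseteq> stage_hull a"
  unfolding stage_hull_def by (rule subset_closure_under)

lemma stage_hull_subset: "a \<in> E \<Longrightarrow> stage_hull a \<subseteq> E"
  unfolding stage_hull_def using seg_subset[of a] by (intro closure_gen_subset) simp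

lemma stage_hull_lepoll:
  assumes "a \<in> stages"
  shows "stage_hull a \<lesssim> seg a"
proof -
  have inf: "infinite (seg a)" using assms by (simp add: stages_def)
  have "stage_hull a \<lesssim> insert a (seg a)"
    unfolding stage_hull_def using inf by (intro closure_under_lepoll finite_gen) auto
  also have "insert a (seg a) \<lesssim> seg a" by (rule infinite_insert_lepoll[OF inf])
  finally show ?thesis .
qed

lemma balanced_piece:
  assumes "a \<in> stages"
  shows "balanced (piece a)"
proof -
  define N where "N = (\<Union>b\<in>stages \<inter> seg a. stage_hull b)"
  have a: "a \<in> E" "infinite (seg a)" using assms by (simp_all add: stages_def)
  have N_sub: "N \<subseteq> stage_hull a" unfolding N_def using stage_hull_mono by auto
  have N_closed: "closed_under gen N \<and> seg a \<subseteq> N" if ne: "stages \<inter> seg a \<noteq> {}"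
  proof
    show "closed_under gen N"
      unfolding N_def
    proof (rule closed_under_UN_chain[OF closed_stage_hull ne])
      fix i j assume "i \<in> stages \<inter> seg a" "j \<in> stages \<inter> seg a"
      then have "i = j \<or> i \<in> seg j \<or> j \<in> seg i"
        by (intro seg_linear) (auto simp: stages_def)
      then show "stage_hull i \<subseteq> stage_hull j \<or> stage_hull j \<subseteq> stage_hull i"
        using stage_hull_mono by auto
    qed
    obtain b where b: "b \<in> stages" "b \<in> seg a" using ne by auto
    show "seg a \<subseteq> N"
    proof
      fix c assume c: "c \<in> seg a"
      show "c \<in> N"
      proof (cases "c \<in> stages")
        case True
        then show ?thesis unfolding N_def using c subset_stage_hull[of c] by auto
      next
        case False
        have "c \<in> E" using c seg_subset by auto
        then have fin: "finite (seg c)" using False by (simp add: stages_def)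
        have "b \<in> E" "infinite (seg b)" using b(1) by (simp_all add: stages_def)
        then have "c \<in> seg b"
          \<comment> \<open>An element with a finite segment precedes every stage, so the hull of
            \<open>b\<close> absorbs it.\<close>
          using seg_linear[OF \<open>c \<in> E\<close> \<open>b \<in> E\<close>] fin finite_subset[OF seg_mono[of b c]] by auto
        then show ?thesis unfolding N_def using b subset_stage_hull[of b] by auto
      qed
    qed
  qed
  show ?thesis
  proof (cases "stages \<inter> seg a \<noteq> {} \<and> a \<in> N")
    case True
    \<comment> \<open>If \<open>a\<close> was captured earlier, its hull adds nothing and the piece
      is empty.\<close>
    then have "stage_hull a \<subseteq> N"
      unfolding stage_hull_def using N_closed by (intro closure_under_least) auto
    then have "piece a = {}" unfolding piece_def N_def by auto
    then show ?thesis using eulerian_balanced[OF eulerian_empty] by simp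
  next
    case False
    have "N = {} \<or> closed_under gen N \<and> seg a \<subseteq> N \<and> a \<notin> N"
    proof (cases "stages \<inter> seg a = {}")
      case True
      then show ?thesis unfolding N_def by simp
    next
      case nonempty: False
      then show ?thesis using N_closed[OF nonempty] False by simp
    qed
    then have "balanced (stage_hull a - N)"
      by (rule balanced_difference[OF a closed_stage_hull stage_hull_subset[OF a(1)]
          subset_stage_hull stage_hull_lepoll[OF assms] N_sub])
    then show ?thesis unfolding piece_def N_def .
  qed
qed

lemma piece_lesspoll:
  assumes "a \<in> stages"
  shows "piece a \<prec> E"
proof -
  have "piece a \<lesssim> stage_hull a" by (rule subset_imp_lepoll) (auto simp: piece_def)
  also have "stage_hull a \<lesssim> seg a" by (rule stage_hull_lepoll[OF assms])
  also have "seg a \<prec> E" using assms by (intro seg_small) (simp add: stages_def)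
  finally show ?thesis .
qed

lemma piece_disjoint:
  assumes "a \<in> stages" "b \<in> stages" "a \<noteq> b"
  shows "piece a \<inter> piece b = {}"
proof -
  have "a \<in> seg b \<or> b \<in> seg a"
    using seg_linear[of a b] assms by (auto simp: stages_def)
  then show ?thesis using assms(1,2) unfolding piece_def by auto
qed

lemma UN_piece:
  assumes "uncountable E"
  shows "(\<Union>a\<in>stages. piece a) = E"
proof
  show "(\<Union>a\<in>stages. piece a) \<subseteq> E"
    using stage_hull_subset unfolding piece_def stages_def by auto
  have "stages \<noteq> {}"
  proof
    assume "stages = {}"
    then have fin: "finite (seg a)" if "a \<in> E" for a using that by (auto simp: stages_def)
    have "card (seg a) < card (seg b)" if "a \<in> seg b" "b \<in> E" for a b
      using that seg_mono[of a b] seg_irrefl[of a] by (intro psubset_card_mono fin) auto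
    \<comment> \<open>With all segments finite, their sizes would number \<open>E\<close>
      injectively by naturals.\<close>
    then have "inj_on (\<lambda>a. card (seg a)) E"
      using seg_linear by (intro inj_onI) (metis less_irrefl)
    then show False using assms countableI by blast
  qed
  then obtain s where s: "s \<in> E" "infinite (seg s)" by (auto simp: stages_def)
  show "E \<subseteq> (\<Union>a\<in>stages. piece a)"
  proof
    fix e assume e: "e \<in> E"
    have "\<exists>a\<in>stages. e \<in> stage_hull a"
    proof (cases "e \<in> stages")
      case True
      then show ?thesis using subset_stage_hull[of e] by auto
    next
      case False
      then have "finite (seg e)" using e by (simp add: stages_def)
      then have "e \<in> seg s"
        using seg_linear[OF e s(1)] s(2) finite_subset[OF seg_mono[of s e]] by auto
      then show ?thesis using s subset_stage_hull[of s] by (auto simp: stages_def)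
    qed
    then obtain a where a: "a \<in> E" "a \<in> stages \<and> e \<in> stage_hull a" by (auto simp: stages_def)
    \<comment> \<open>The first stage whose hull contains \<open>e\<close> is the one whose piece
      contains it.\<close>
    obtain b where b: "b \<in> stages" "e \<in> stage_hull b"
      "\<And>c. c \<in> E \<Longrightarrow> c \<in> stages \<and> e \<in> stage_hull c \<Longrightarrow> c \<notin> seg b"
      using least_exists[of a "\<lambda>a. a \<in> stages \<and> e \<in> stage_hull a", OF a] by metis
    then have "e \<in> piece b" unfolding piece_def by (auto simp: stages_def)
    then show "e \<in> (\<Union>a\<in>stages. piece a)" using b(1) by auto
  qed
qed

end

context wf_digraph
begin

text \<open>Ranging over all balanced subsets of \<open>arcs G\<close> lets the induction on
  cardinality apply to the pieces.\<close>

theorem balanced_decomposable: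
  assumes "E \<subseteq> arcs G" "balanced E"
  shows "decomposable E"
proof -
  have "wf {(A :: 'b set, B). A \<prec> B}"
    by (rule wf_subset[OF wf_inv_image[OF wf_ordLess, of card_of]])
      (auto simp: inv_image_def lesspoll_iff_ordLess)
  then show ?thesis using assms
  proof (induction E rule: wf_induct_rule)
    case (less E)
    show ?case
    proof (cases "countable E")
      case True
      then show ?thesis
        using countable_decomposable balanced_finitely_eulerian less.prems by blast
    next
      case False
      obtain seg where seg: "initial_segments E seg" by (rule initial_segments_exist)
      interpret segmented_digraph G E seg
        by (intro segmented_digraph.intro seg segmented_digraph_axioms.intro less.prems)
          unfold_locales
      have "decomposable (\<Union>a\<in>stages. piece a)"
      proof (rule decomposable_UN[OF _ piece_disjoint])
        fix a assume a: "a \<in> stages"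
        have "piece a \<subseteq> E" using UN_piece[OF False] a by auto
        then show "decomposable (piece a)"
          using less.prems(1) balanced_piece[OF a] piece_lesspoll[OF a] by (intro less.IH) auto
      qed
      then show ?thesis unfolding UN_piece[OF False] .
    qed
  qed
qed

section \<open>Cuts of the digraph and the easy direction\<close>

lemma out_cut_eq: "out_cut G X = cut (arcs G) X"
  unfolding out_cut_def cut_def using wellformed by auto

lemma in_cut_eq: "X \<subseteq> verts G \<Longrightarrow> in_cut G X = cut (arcs G) (- X)"
  unfolding in_cut_def cut_def using wellformed by auto

lemma cut_Int_verts:
  assumes "E \<subseteq> arcs G"
  shows "cut E (X \<inter> verts G) = cut E X" "cut E (- (X \<inter> verts G)) = cut E (- X)"
  unfolding cut_def using assms wellformed by auto

text \<open>Each cycle contributes equally many arcs to both cuts, and the bijections for the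
  disjoint cycles glue together.\<close>

lemma decomposable_imp_cut_eqpoll:
  assumes "decomposable E"
  shows "cut E X \<approx> cut E (- X)"
proof -
  obtain P where P: "partition_on E P" "\<forall>C\<in>P. dicycle_arcs G C"
    using assms unfolding decomposable_def by blast
  have E: "\<Union> P = E" and disj: "disjoint P" using P(1) by (simp_all add: partition_on_def)
  have eq: "cut E Y = (\<Union>C\<in>P. cut C Y)" for Y unfolding E[symmetric] cut_def by auto
  have pairwise: "pairwise (\<lambda>C C'. disjnt (cut C Y) (cut C' Y)) P" for Y
    using disjointD[OF disj] unfolding pairwise_def disjnt_def cut_def by fast
  have "cut C X \<approx> cut C (- X)" if "C \<in> P" for C
    using dicycle_eulerian[of C] P(2) that by (simp add: eulerian_def eqpoll_iff_card finite_cut)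
  then show ?thesis unfolding eq using pairwise by (intro UN_eqpoll_UN)
qed

end

theorem theorem2:
  fixes D :: "('a, 'b) pre_digraph"
  assumes "wf_digraph D"
  shows "(\<exists>P. dicycle_partition D P) \<longleftrightarrow>
    (\<forall>X. X \<subseteq> verts D \<longrightarrow> in_cut D X \<approx> out_cut D X)"
proof -
  interpret wf_digraph D by (rule assms)
  have "(\<exists>P. dicycle_partition D P) \<longleftrightarrow> decomposable (arcs D)"
    unfolding dicycle_partition_def decomposable_def ..
  also have "\<dots> \<longleftrightarrow> (\<forall>X. X \<subseteq> verts D \<longrightarrow> in_cut D X \<approx> out_cut D X)"
  proof
    assume "decomposable (arcs D)"
    then show "\<forall>X. X \<subseteq> verts D \<longrightarrow> in_cut D X \<approx> out_cut D X"
      by (simp add: in_cut_eq out_cut_eq eqpoll_sym[OF decomposable_imp_cut_eqpoll])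
  next
    assume cuts: "\<forall>X. X \<subseteq> verts D \<longrightarrow> in_cut D X \<approx> out_cut D X"
    have "cut (arcs D) X \<lesssim> cut (arcs D) (- X)" for X
    proof -
      have "in_cut D (X \<inter> verts D) \<approx> out_cut D (X \<inter> verts D)" using cuts by simp
      then have "cut (arcs D) (- X) \<approx> cut (arcs D) X"
        unfolding in_cut_eq[OF Int_lower2] out_cut_eq cut_Int_verts[OF subset_refl] .
      then show ?thesis by (rule eqpoll_imp_lepoll[OF eqpoll_sym])
    qed
    then show "decomposable (arcs D)"
      by (simp add: balanced_decomposable balanced_def)
  qed
  finally show ?thesis .
qed

end
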